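(* There is an algorithm (based on dynamic programming) which, given a jury $J_n$ of odd size $n$ by its individual error rates $\epsilon_1,\dots,\epsilon_n \in (0,1)$, computes $JER(J_n)$ using at most $O(n^2)$ time and at most $O(n)$ space.
   Context: A jury $J_n=\{j_1,\dots,j_n\}$ is a set of $n$ jurors, $n$ odd. Individual error rate $\epsilon_i$ is the probability that juror $j_i$ votes wrongly; jurors err independently. The jury error rate under majority voting is the probability that at least $\frac{n+1}{2}$ of the jurors vote wrongly: $$JER(J_n) = \sum_{k=\frac{n+1}{2}}^{n} \ \sum_{A \subseteq \{1,\dots,n\},\ |A| = k} \ \prod_{i \in A} \epsilon_i \prod_{i \notin A} (1-\epsilon_i).$$ Cost model: each arithmetic operation on real numbers takes $O(1)$ time and each stored real number takes $O(1)$ space. *)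

theory Defs
  imports Complex_Main "HOL-Library.Landau_Symbols"
begin

definition JER :: "nat \<Rightarrow> (nat \<Rightarrow> real) \<Rightarrow> real" where
  "JER n \<epsilon> = (\<Sum>k = (n + 1) div 2..n. \<Sum>A | A \<subseteq> {1..n} \<and> card A = k.
     (\<Prod>i\<in>A. \<epsilon> i) * (\<Prod>i\<in>{1..n} - A. 1 - \<epsilon> i))"

text \<open>
  A real RAM. A program is a fixed finite list of instructions, the same for every input size. The
  machine has index registers holding natural numbers and an unbounded memory of cells holding
  real numbers. Every memory operand is indirect: it names an index register whose content is the
  address of the cell. No instruction converts a real number to a natural number, real constants
  are integers, and index registers only support assignment, copying, increment and
  decrement, so their contents exceed the input size by at most a constant plus the running time
  and cannot serve as unbounded storage.
\<close>

datatype arith = Add | Sub | Mul | Div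

fun arith_val :: "arith \<Rightarrow> real \<Rightarrow> real \<Rightarrow> real" where
  "arith_val Add x y = x + y"
| "arith_val Sub x y = x - y"
| "arith_val Mul x y = x * y"
| "arith_val Div x y = x / y"

text \<open>
  Parameter types: \<open>ireg\<close> is the name of an index register, \<open>label\<close> a position in the
  program.
\<close>

type_synonym ireg = nat
type_synonym label = nat

datatype instr =
    RConst ireg int
  | RMove ireg ireg
  | RArith arith ireg ireg ireg
  | RJumpLess ireg ireg label
  | IConst ireg nat
  | IMove ireg ireg
  | IInc ireg
  | IDec ireg
  | IJumpLess ireg ireg label
  | Jump label
  | Halt

type_synonym program = "instr list"

record config =
  pc :: label
  idx :: "ireg \<Rightarrow> nat"
  cell :: "nat \<Rightarrow> real"

definition set_cell :: "ireg \<Rightarrow> real \<Rightarrow> config \<Rightarrow> config" where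
  "set_cell a x c = c\<lparr>pc := pc c + 1, cell := (cell c)(idx c a := x)\<rparr>"

definition set_idx :: "ireg \<Rightarrow> nat \<Rightarrow> config \<Rightarrow> config" where
  "set_idx a k c = c\<lparr>pc := pc c + 1, idx := (idx c)(a := k)\<rparr>"

definition branch :: "bool \<Rightarrow> label \<Rightarrow> config \<Rightarrow> config" where
  "branch b l c = c\<lparr>pc := if b then l else pc c + 1\<rparr>"

text \<open>
  \<open>None\<close> means that there is no next configuration. Division by zero is such a failure
  rather than yielding the value \<open>x / 0 = 0\<close>.
\<close>

fun exec :: "instr \<Rightarrow> config \<Rightarrow> config option" where
  "exec (RConst a z) c = Some (set_cell a (of_int z) c)"
| "exec (RMove a b) c = Some (set_cell a (cell c (idx c b)) c)"
| "exec (RArith f a b d) c =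
     (if f = Div \<and> cell c (idx c d) = 0 then None
      else Some (set_cell a (arith_val f (cell c (idx c b)) (cell c (idx c d))) c))"
| "exec (RJumpLess a b l) c = Some (branch (cell c (idx c a) < cell c (idx c b)) l c)"
| "exec (IConst a k) c = Some (set_idx a k c)"
| "exec (IMove a b) c = Some (set_idx a (idx c b) c)"
| "exec (IInc a) c = Some (set_idx a (idx c a + 1) c)"
| "exec (IDec a) c = Some (set_idx a (idx c a - 1) c)"
| "exec (IJumpLess a b l) c = Some (branch (idx c a < idx c b) l c)"
| "exec (Jump l) c = Some (branch True l c)"
| "exec Halt c = None"

fun real_operands :: "instr \<Rightarrow> ireg set" where
  "real_operands (RConst a z) = {a}"
| "real_operands (RMove a b) = {a, b}"
| "real_operands (RArith f a b d) = {a, b, d}"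
| "real_operands (RJumpLess a b l) = {a, b}"
| "real_operands _ = {}"

fun index_operands :: "instr \<Rightarrow> ireg set" where
  "index_operands (IConst a k) = {a}"
| "index_operands (IMove a b) = {a, b}"
| "index_operands (IInc a) = {a}"
| "index_operands (IDec a) = {a}"
| "index_operands (IJumpLess a b l) = {a, b}"
| "index_operands _ = {}"

definition accessed :: "instr \<Rightarrow> config \<Rightarrow> nat set" where
  "accessed I c = idx c ` real_operands I"

definition index_registers :: "program \<Rightarrow> ireg set" where
  "index_registers P = (\<Union>I\<in>set P. real_operands I \<union> index_operands I)"

text \<open>
  \<open>run P c t M c'\<close>: from \<open>c\<close>, the program reaches \<open>c'\<close> after exactly \<open>t\<close> instructions, and
  \<open>M\<close> is the set of addresses of all memory cells read or written on the way.
\<close>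

inductive run :: "program \<Rightarrow> config \<Rightarrow> nat \<Rightarrow> nat set \<Rightarrow> config \<Rightarrow> bool" for P where
  run_0: "run P c 0 {} c"
| run_Suc: "\<lbrakk>pc c < length P; exec (P ! pc c) c = Some c'; run P c' t M c''\<rbrakk>
    \<Longrightarrow> run P c (Suc t) (accessed (P ! pc c) c \<union> M) c''"

definition halted :: "program \<Rightarrow> config \<Rightarrow> bool" where
  "halted P c \<longleftrightarrow> pc c < length P \<and> P ! pc c = Halt"

text \<open>
  The size \<open>n\<close> is passed in index register 0 and the input in cells \<open>1, \<dots>, n\<close>; the result is
  left in cell 0. All other registers and cells start at 0.
\<close>

definition init :: "nat \<Rightarrow> (nat \<Rightarrow> real) \<Rightarrow> config" where
  "init n x = \<lparr>pc = 0, idx = (\<lambda>_. 0)(0 := n), cell = (\<lambda>a. if a \<in> {1..n} then x a else 0)\<rparr>"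

text \<open>
  Time counts every executed instruction, index and control instructions included. Space counts
  the distinct memory cells ever accessed, the input and output cells and the index registers.
\<close>

definition computes_within ::
    "program \<Rightarrow> nat \<Rightarrow> (nat \<Rightarrow> real) \<Rightarrow> real \<Rightarrow> nat \<Rightarrow> nat \<Rightarrow> bool" where
  "computes_within P n x y time space \<longleftrightarrow>
     (\<exists>t M c. run P (init n x) t M c \<and> halted P c \<and> cell c 0 = y \<and>
        t \<le> time \<and> card (M \<union> {0..n}) + card (index_registers P) \<le> space)"

end

theory Submission imports Defs begin

text \<open>
  The probability that at least \<open>k + 1\<close> of the jurors \<open>insert i A\<close> err is
  \<open>t\<^sub>A (k + 1) + \<epsilon>\<^sub>i (t\<^sub>A k - t\<^sub>A (k + 1))\<close>, where \<open>t\<^sub>A k\<close> is the probability that at least \<open>k\<close>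
  of the jurors \<open>A\<close> err. Adding the jurors one at a time and updating a table of these tail
  probabilities in place, from large \<open>k\<close> to small \<open>k\<close>, takes quadratic time and linear space,
  and the jury error rate is the table entry for \<open>k = (n + 1) div 2\<close>.
\<close>

section \<open>Tail probabilities of the number of wrong votes\<close>

definition tail_prob :: "'a set \<Rightarrow> ('a \<Rightarrow> real) \<Rightarrow> nat \<Rightarrow> real" where
  "tail_prob A \<epsilon> k =
     (\<Sum>B\<in>Pow A. if k \<le> card B then (\<Prod>i\<in>B. \<epsilon> i) * (\<Prod>i\<in>A - B. 1 - \<epsilon> i) else 0)"

lemma sum_Pow_insert:
  fixes g :: "'a set \<Rightarrow> 'b::comm_monoid_add"
  assumes "finite A" "i \<notin> A"
  shows "sum g (Pow (insert i A)) = (\<Sum>B\<in>Pow A. g B) + (\<Sum>B\<in>Pow A. g (insert i B))"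
\<comment> \<open>Subsets are split by whether they contain \<open>i\<close>, that is, by the vote
  of the added juror.\<close>
proof -
  have "inj_on (insert i) (Pow A)"
    using assms(2) by (auto simp: inj_on_def)
  moreover have "Pow A \<inter> insert i ` Pow A = {}"
    using assms(2) by auto
  ultimately show ?thesis
    using assms(1) by (simp add: Pow_insert sum.union_disjoint sum.reindex)
qed

lemma weight_insert:
  fixes \<epsilon> :: "'a \<Rightarrow> real"
  assumes "finite A" "i \<notin> A" "B \<subseteq> A"
  shows "(\<Prod>j\<in>B. \<epsilon> j) * (\<Prod>j\<in>insert i A - B. 1 - \<epsilon> j)
           = (1 - \<epsilon> i) * ((\<Prod>j\<in>B. \<epsilon> j) * (\<Prod>j\<in>A - B. 1 - \<epsilon> j))"
proof -
  have "insert i A - B = insert i (A - B)"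
    using assms by auto
  then show ?thesis
    using assms by simp
qed

text \<open>Conditioning on the vote of \<open>i\<close>: a right vote leaves \<open>k\<close>
  errors to be found in \<open>A\<close>, a wrong one only \<open>k - 1\<close>. Truncated
  subtraction is harmless, since \<open>k \<le> Suc m\<close> and \<open>k - 1 \<le> m\<close> agree
  even for \<open>k = 0\<close>.\<close>

lemma tail_prob_insert:
  assumes "finite A" "i \<notin> A"
  shows "tail_prob (insert i A) \<epsilon> k
           = (1 - \<epsilon> i) * tail_prob A \<epsilon> k + \<epsilon> i * tail_prob A \<epsilon> (k - 1)"
proof -
  have card: "card (insert i B) = Suc (card B)" if "B \<in> Pow A" for B
    using that assms finite_subset[of B A] by (auto simp: card_insert_if)
  have fin: "finite B" "i \<notin> B" if "B \<in> Pow A" for B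
    using that assms finite_subset[of B A] by auto
  have "tail_prob (insert i A) \<epsilon> k
      = (\<Sum>B\<in>Pow A. (1 - \<epsilon> i) * (if k \<le> card B then (\<Prod>j\<in>B. \<epsilon> j) * (\<Prod>j\<in>A - B. 1 - \<epsilon> j) else 0))
      + (\<Sum>B\<in>Pow A. \<epsilon> i * (if k - 1 \<le> card B then (\<Prod>j\<in>B. \<epsilon> j) * (\<Prod>j\<in>A - B. 1 - \<epsilon> j) else 0))"
    unfolding tail_prob_def sum_Pow_insert[OF assms]
    by (intro arg_cong2[where f = "(+)"] sum.cong refl)
       (use assms card fin in \<open>auto simp: weight_insert\<close>)
  then show ?thesis
    by (simp add: tail_prob_def sum_distrib_left)
qed

text \<open>At \<open>k = 0\<close> the recurrence averages one value with itself, so the total mass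
  1 of the empty jury persists.\<close>

lemma tail_prob_0: "finite A \<Longrightarrow> tail_prob A \<epsilon> 0 = 1"
proof (induction A rule: finite_induct)
  case empty
  then show ?case by (simp add: tail_prob_def)
next
  case (insert i A)
  then show ?case by (simp add: tail_prob_insert)
qed

text \<open>Because of this, table cells not yet reached, which are initially 0, already hold the
  right values.\<close>

lemma tail_prob_eq_0:
  assumes "finite A" "card A < k"
  shows "tail_prob A \<epsilon> k = 0"
  unfolding tail_prob_def
proof (rule sum.neutral, intro ballI if_not_P)
  fix B assume "B \<in> Pow A"
  then have "card B \<le> card A" using assms(1) by (simp add: card_mono)
  then show "\<not> k \<le> card B" using assms(2) by simp
qed

lemma JER_eq_tail_prob: "JER n \<epsilon> = tail_prob {1..n} \<epsilon> ((n + 1) div 2)"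
proof -
  let ?m = "(n + 1) div 2"
  let ?w = "\<lambda>B. (\<Prod>i\<in>B. \<epsilon> i) * (\<Prod>i\<in>{1..n} - B. 1 - \<epsilon> i)"
  let ?S = "{B \<in> Pow {1..n}. ?m \<le> card B}"
  \<comment> \<open>Grouping the subsets by cardinality in \<open>?m..n\<close> therefore loses none
    of them.\<close>
  have card: "card ` ?S \<subseteq> {?m..n}"
    using card_mono[of "{1..n}"] by fastforce
  have "JER n \<epsilon> = (\<Sum>k = ?m..n. sum ?w {B \<in> ?S. card B = k})"
    unfolding JER_def by (intro sum.cong refl) auto
  also have "\<dots> = sum ?w ?S"
    using card by (intro sum.group) auto
  also have "\<dots> = tail_prob {1..n} \<epsilon> ?m"
    unfolding tail_prob_def by (rule sum.inter_filter) simp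
  finally show ?thesis .
qed

section \<open>Runs with upper bounds on time and memory\<close>

definition reaches :: "program \<Rightarrow> nat \<Rightarrow> nat set \<Rightarrow> config \<Rightarrow> config \<Rightarrow> bool" where
  "reaches P t N c c' \<longleftrightarrow> (\<exists>s M. s \<le> t \<and> M \<subseteq> N \<and> run P c s M c')"

lemma run_trans:
  "run P c s M c' \<Longrightarrow> run P c' t N c'' \<Longrightarrow> run P c (s + t) (M \<union> N) c''"
proof (induction rule: run.induct)
  case (run_0 c)
  then show ?case by simp
next
  case (run_Suc c c' t' M c'')
  then show ?case using run.run_Suc[of c P c'] by (simp add: Un_assoc)
qed

lemma reaches_refl: "reaches P t N c c"
  unfolding reaches_def using run_0 by blast

text \<open>Times add up, whereas a single memory bound \<open>N\<close> serves all phases, since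
  cells are reused.\<close>

lemma reaches_trans:
  assumes "reaches P s N c c'" "reaches P t N c' c''"
  shows "reaches P (s + t) N c c''"
  using assms unfolding reaches_def by (meson run_trans add_mono Un_least)

lemma reaches_mono:
  assumes "reaches P s N c c'" "s \<le> t" "N \<subseteq> N'"
  shows "reaches P t N' c c'"
  using assms unfolding reaches_def by (meson order_trans)

text \<open>Applied repeatedly as a rule, this executes straight-line code symbolically.\<close>

lemma reaches_step:
  assumes "pc c < length P" "exec (P ! pc c) c = Some c'" "accessed (P ! pc c) c \<subseteq> N"
    and "reaches P t N c' c''"
  shows "reaches P (Suc t) N c c''"
  using assms unfolding reaches_def by (meson run_Suc Suc_le_mono Un_least)

section \<open>The program and its loops\<close>

text \<open>
  Register 0 is the current juror and hence the address of its error rate;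
  2 and 3 address consecutive table entries, 4 is constantly 0 (so it addresses the scratch and
  output cell 0), 5 addresses the base \<open>n + 1\<close> of the table, 6 its last entry that may be
  nonzero. The jurors are added from \<open>n\<close> down to 1. The last loop
  moves registers 5 and 6 towards each other until 5 reaches the middle of the table.
\<close>

definition jer_program :: program where
  "jer_program =
    [IMove 5 0, IInc 5, RConst 5 1, IMove 6 5,
     IInc 6, IMove 2 6,
     IMove 3 2, IDec 3,
     RArith Sub 4 3 2, RArith Mul 4 4 0, RArith Add 2 2 4,
     IDec 2, IJumpLess 5 2 6,
     IDec 0, IJumpLess 4 0 4,
     IInc 5, IDec 6, IJumpLess 5 6 15,
     RMove 4 5, Halt]"

lemmas step_simps =
  jer_program_def set_idx_def set_cell_def branch_def accessed_def


text \<open>One pass through instructions 6 to 12. \<open>0 < f 0\<close> keeps the error rate out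
  of scratch cell 0, where \<open>d\<close> is built, and \<open>f 0 < f 5\<close> keeps it below
  the table.\<close>

lemma inner_body:
  assumes "f 2 = Suc a" "f 4 = 0" "0 < f 0" "f 0 < f 5" "f 5 \<le> a" "Suc a \<le> N"
    and "d = (g a - g (Suc a)) * g (f 0)"
  shows "reaches jer_program 7 {0..N} \<lparr>pc = 6, idx = f, cell = g\<rparr>
     \<lparr>pc = if f 5 < a then 6 else 13, idx = f(3 := a, 2 := a),
      cell = g(0 := d, Suc a := g (Suc a) + d)\<rparr>"
proof -
  \<comment> \<open>The \<open>Suc\<close> form lets each use of \<open>reaches_step\<close> consume
    one instruction.\<close>
  have "reaches jer_program (Suc (Suc (Suc (Suc (Suc (Suc (Suc 0)))))))
      {0..N} \<lparr>pc = 6, idx = f, cell = g\<rparr>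
      \<lparr>pc = if f 5 < a then 6 else 13, idx = f(3 := a, 2 := a),
       cell = g(0 := d, Suc a := g (Suc a) + d)\<rparr>"
    by (rule reaches_step, (use assms in \<open>simp add: step_simps\<close>; fail)+)+
       (use assms in \<open>simp add: reaches_refl\<close>)
  then show ?thesis by (simp add: numeral_eq_Suc)
qed

text \<open>Going downwards, each update reads the entry below before that entry changes, so the
  result depends on the old \<open>g\<close> alone. Cell 0 is exempt as scratch space.\<close>

lemma inner_loop:
  assumes "f 2 = f 5 + Suc k" "f 4 = 0" "0 < f 0" "f 0 < f 5" "f 5 + Suc k \<le> N"
  shows "\<exists>g'. reaches jer_program (7 * Suc k) {0..N} \<lparr>pc = 6, idx = f, cell = g\<rparr>
       \<lparr>pc = 13, idx = f(3 := f 5, 2 := f 5), cell = g'\<rparr> \<and>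
     (\<forall>a>0. g' a = (if f 5 < a \<and> a \<le> f 5 + Suc k
        then g a + (g (a - 1) - g a) * g (f 0) else g a))"
  using assms
proof (induction k arbitrary: f g)
  case 0
  then show ?case
    using inner_body[of f "f 5" N "(g (f 5) - g (Suc (f 5))) * g (f 0)" g]
    by (intro exI[of _ "g(0 := (g (f 5) - g (Suc (f 5))) * g (f 0),
          Suc (f 5) := g (Suc (f 5)) + (g (f 5) - g (Suc (f 5))) * g (f 0))"])
       (auto simp: le_Suc_eq fun_upd_def)
next
  case (Suc k)
  let ?a = "f 5 + Suc k"
  let ?f = "f(3 := ?a, 2 := ?a)"
  let ?d = "(g ?a - g (Suc ?a)) * g (f 0)"
  let ?g = "g(0 := ?d, Suc ?a := g (Suc ?a) + ?d)"
  have step: "reaches jer_program 7 {0..N} \<lparr>pc = 6, idx = f, cell = g\<rparr>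
      \<lparr>pc = 6, idx = ?f, cell = ?g\<rparr>"
    using inner_body[of f ?a N ?d g] Suc.prems by simp
  have "\<exists>g'. reaches jer_program (7 * Suc k) {0..N} \<lparr>pc = 6, idx = ?f, cell = ?g\<rparr>
       \<lparr>pc = 13, idx = ?f(3 := ?f 5, 2 := ?f 5), cell = g'\<rparr> \<and>
     (\<forall>a>0. g' a = (if ?f 5 < a \<and> a \<le> ?f 5 + Suc k
        then ?g a + (?g (a - 1) - ?g a) * ?g (?f 0) else ?g a))"
    by (rule Suc.IH) (use Suc.prems in simp_all)
  then obtain g' where rest:
    "reaches jer_program (7 * Suc k) {0..N} \<lparr>pc = 6, idx = ?f, cell = ?g\<rparr>
       \<lparr>pc = 13, idx = ?f(3 := ?f 5, 2 := ?f 5), cell = g'\<rparr>"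
    and g': "\<forall>a>0. g' a = (if ?f 5 < a \<and> a \<le> ?f 5 + Suc k
        then ?g a + (?g (a - 1) - ?g a) * ?g (?f 0) else ?g a)"
    by blast
  have f: "?f(3 := ?f 5, 2 := ?f 5) = f(3 := f 5, 2 := f 5)"
    by (simp add: fun_eq_iff)
  have "reaches jer_program (7 * Suc (Suc k)) {0..N} \<lparr>pc = 6, idx = f, cell = g\<rparr>
       \<lparr>pc = 13, idx = f(3 := f 5, 2 := f 5), cell = g'\<rparr>"
    using reaches_trans[OF step rest[unfolded f]] by (rule reaches_mono) simp_all
  \<comment> \<open>The top entry \<open>Suc ?a\<close> is changed only by the first pass; the
    remaining passes neither read nor write it.\<close>
  moreover have "g' a = (if f 5 < a \<and> a \<le> f 5 + Suc (Suc k)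
        then g a + (g (a - 1) - g a) * g (f 0) else g a)" if "0 < a" for a
    using g'[rule_format, OF that] that Suc.prems by (cases "a = Suc ?a") auto
  ultimately show ?case by blast
qed

text \<open>The 4 extra instructions are the two that extend the table and set its cursor, and the
  two that move on to the next juror.\<close>

lemma outer_body:
  assumes "f 6 = f 5 + j" "f 4 = 0" "0 < f 0" "f 0 < f 5" "f 5 + Suc j \<le> N"
  shows "\<exists>g'. reaches jer_program (7 * Suc j + 4) {0..N} \<lparr>pc = 4, idx = f, cell = g\<rparr>
       \<lparr>pc = if 1 < f 0 then 4 else 15,
        idx = f(6 := f 5 + Suc j, 3 := f 5, 2 := f 5, 0 := f 0 - 1), cell = g'\<rparr> \<and>
     (\<forall>a>0. g' a = (if f 5 < a \<and> a \<le> f 5 + Suc j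
        then g a + (g (a - 1) - g a) * g (f 0) else g a))"
proof -
  let ?b = "f 5 + Suc j"
  let ?f = "f(6 := ?b, 2 := ?b)"
  let ?f' = "?f(3 := f 5, 2 := f 5)"
  let ?f'' = "f(6 := ?b, 3 := f 5, 2 := f 5, 0 := f 0 - 1)"
  have enter: "reaches jer_program (Suc (Suc 0)) {0..N} \<lparr>pc = 4, idx = f, cell = g\<rparr>
      \<lparr>pc = 6, idx = ?f, cell = g\<rparr>"
    by (rule reaches_step, (use assms in \<open>simp add: step_simps\<close>; fail)+)+
       (use assms in \<open>simp add: reaches_refl\<close>)
  obtain g' where loop: "reaches jer_program (7 * Suc j) {0..N} \<lparr>pc = 6, idx = ?f, cell = g\<rparr>
       \<lparr>pc = 13, idx = ?f', cell = g'\<rparr>"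
    and g': "\<forall>a>0. g' a = (if f 5 < a \<and> a \<le> f 5 + Suc j
        then g a + (g (a - 1) - g a) * g (f 0) else g a)"
    using inner_loop[of ?f j N g] assms by auto
  have leave: "reaches jer_program (Suc (Suc 0)) {0..N} \<lparr>pc = 13, idx = ?f', cell = g'\<rparr>
      \<lparr>pc = if 1 < f 0 then 4 else 15, idx = ?f'', cell = g'\<rparr>"
    by (rule reaches_step, (use assms in \<open>simp add: step_simps\<close>; fail)+)+
       (use assms in \<open>simp add: fun_upd_twist reaches_refl\<close>)
  have "reaches jer_program (7 * Suc j + 4) {0..N} \<lparr>pc = 4, idx = f, cell = g\<rparr>
      \<lparr>pc = if 1 < f 0 then 4 else 15, idx = ?f'', cell = g'\<rparr>"
    using reaches_trans[OF enter reaches_trans[OF loop leave]] by (rule reaches_mono) auto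
  with g' show ?thesis by blast
qed

text \<open>Loop invariant: jurors above \<open>Suc i\<close> have been added, the error rates of
  the others are intact, and the table is correct for all \<open>k\<close>, including entries beyond
  register 6.\<close>

lemma outer_step:
  assumes "f 0 = Suc i" "f 4 = 0" "f 5 = n + 1" "f 6 = f 5 + (n - Suc i)" "Suc i \<le> n"
    and input: "\<forall>a\<in>{1..Suc i}. g a = \<epsilon> a"
    and table: "\<forall>k. g (n + 1 + k) = tail_prob {Suc i<..n} \<epsilon> k"
  shows "\<exists>f' g'. reaches jer_program (7 * n + 4) {0..2 * n + 1}
       \<lparr>pc = 4, idx = f, cell = g\<rparr> \<lparr>pc = if 0 < i then 4 else 15, idx = f', cell = g'\<rparr> \<and>
     f' 0 = i \<and> f' 4 = 0 \<and> f' 5 = n + 1 \<and> f' 6 = f' 5 + (n - i) \<and>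
     (\<forall>a\<in>{1..i}. g' a = \<epsilon> a) \<and> (\<forall>k. g' (n + 1 + k) = tail_prob {i<..n} \<epsilon> k)"
proof -
  let ?f' = "f(6 := n + 1 + (n - i), 3 := n + 1, 2 := n + 1, 0 := Suc i - 1)"
  have j: "Suc (n - Suc i) = n - i" and e: "g (Suc i) = \<epsilon> (Suc i)"
    using assms by auto
  have pre: "f 6 = n + 1 + (n - Suc i)" "0 < Suc i" "Suc i < n + 1" "n + 1 + (n - i) \<le> 2 * n + 1"
    using assms by auto
  obtain g' where run: "reaches jer_program (7 * (n - i) + 4) {0..2 * n + 1}
       \<lparr>pc = 4, idx = f, cell = g\<rparr> \<lparr>pc = if 1 < Suc i then 4 else 15, idx = ?f', cell = g'\<rparr>"
    and g': "\<forall>a>0. g' a = (if n + 1 < a \<and> a \<le> n + 1 + (n - i)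
        then g a + (g (a - 1) - g a) * \<epsilon> (Suc i) else g a)"
    using outer_body[of f "n - Suc i" "2 * n + 1" g, unfolded j assms(1,3) e,
        OF pre(1) assms(2) pre(2-4)] by blast
  have set: "{i<..n} = insert (Suc i) {Suc i<..n}"
    using assms(5) by auto
  have "g' (n + 1 + k) = tail_prob {i<..n} \<epsilon> k" for k
  proof (cases k)
    case 0
    \<comment> \<open>The base cell \<open>n + 1\<close> is never updated and keeps the value
      1.\<close>
    then show ?thesis using g' table[rule_format, of 0] by (simp add: tail_prob_0)
  next
    case (Suc l)
    show ?thesis
    proof (cases "k \<le> n - i")
      case True
      \<comment> \<open>The update is the recurrence rewritten as
        \<open>t k + (t (k - 1) - t k) * \<epsilon> (Suc i)\<close>.\<close>
      with Suc have "Suc (l + n) \<le> n + n - i" by linarith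
      with True show ?thesis
        using g' table[rule_format, of k] table[rule_format, of l] Suc
        by (simp add: set tail_prob_insert algebra_simps)
    next
      case False
      \<comment> \<open>The cell is untouched, and both tail probabilities vanish because
        \<open>k\<close> exceeds the number of jurors added.\<close>
      then show ?thesis
        using g' table[rule_format, of k] by (simp add: tail_prob_eq_0)
    qed
  qed
  moreover have "\<forall>a\<in>{1..i}. g' a = \<epsilon> a"
    using g' input assms(5) by auto
  moreover have "reaches jer_program (7 * n + 4) {0..2 * n + 1}
       \<lparr>pc = 4, idx = f, cell = g\<rparr> \<lparr>pc = if 0 < i then 4 else 15, idx = ?f', cell = g'\<rparr>"
    using run[THEN reaches_mono, of "7 * n + 4" "{0..2 * n + 1}"] by simp
  ultimately show ?thesis
    using assms by (intro exI[of _ ?f'] exI[of _ g']) simp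
qed

lemma outer_loop:
  assumes "f 0 = Suc i" "f 4 = 0" "f 5 = n + 1" "f 6 = f 5 + (n - Suc i)" "Suc i \<le> n"
    and "\<forall>a\<in>{1..Suc i}. g a = \<epsilon> a" "\<forall>k. g (n + 1 + k) = tail_prob {Suc i<..n} \<epsilon> k"
  shows "\<exists>f' g'. reaches jer_program (Suc i * (7 * n + 4)) {0..2 * n + 1}
       \<lparr>pc = 4, idx = f, cell = g\<rparr> \<lparr>pc = 15, idx = f', cell = g'\<rparr> \<and>
     f' 4 = 0 \<and> f' 5 = n + 1 \<and> f' 6 = 2 * n + 1 \<and>
     (\<forall>k. g' (n + 1 + k) = tail_prob {0<..n} \<epsilon> k)"
  using assms
proof (induction i arbitrary: f g)
  case (0 f g)
  from outer_step[OF 0] obtain f' g' where "reaches jer_program (7 * n + 4) {0..2 * n + 1}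
       \<lparr>pc = 4, idx = f, cell = g\<rparr> \<lparr>pc = 15, idx = f', cell = g'\<rparr>"
    "f' 4 = 0" "f' 5 = n + 1" "f' 6 = 2 * n + 1" "\<forall>k. g' (n + 1 + k) = tail_prob {0<..n} \<epsilon> k"
    by (auto simp: mult_2)
  then show ?case by (intro exI[of _ f'] exI[of _ g']) simp
next
  case (Suc i f g)
  obtain f1 g1 where step: "reaches jer_program (7 * n + 4) {0..2 * n + 1}
       \<lparr>pc = 4, idx = f, cell = g\<rparr> \<lparr>pc = 4, idx = f1, cell = g1\<rparr>"
    and inv: "f1 0 = Suc i" "f1 4 = 0" "f1 5 = n + 1" "f1 6 = f1 5 + (n - Suc i)"
     "\<forall>a\<in>{1..Suc i}. g1 a = \<epsilon> a" "\<forall>k. g1 (n + 1 + k) = tail_prob {Suc i<..n} \<epsilon> k"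
    using outer_step[OF Suc.prems] by auto
  have "Suc i \<le> n" using Suc.prems by simp
  from Suc.IH[OF inv(1-4) this inv(5,6)] obtain f' g' where
    rest: "reaches jer_program (Suc i * (7 * n + 4)) {0..2 * n + 1}
       \<lparr>pc = 4, idx = f1, cell = g1\<rparr> \<lparr>pc = 15, idx = f', cell = g'\<rparr>"
    and res: "f' 4 = 0" "f' 5 = n + 1" "f' 6 = 2 * n + 1"
     "\<forall>k. g' (n + 1 + k) = tail_prob {0<..n} \<epsilon> k" by blast
  have "reaches jer_program (Suc (Suc i) * (7 * n + 4)) {0..2 * n + 1}
       \<lparr>pc = 4, idx = f, cell = g\<rparr> \<lparr>pc = 15, idx = f', cell = g'\<rparr>"
    using reaches_trans[OF step rest] by simp
  with res show ?case by blast
qed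

text \<open>Each round shrinks the odd gap between registers 5 and 6 by 2, so they cross after
  \<open>k + 1\<close> rounds. This halves the gap without a division of indices.\<close>

lemma final_loop:
  assumes "f 6 = f 5 + 2 * k + 1"
  shows "reaches jer_program (3 * Suc k) N \<lparr>pc = 15, idx = f, cell = g\<rparr>
     \<lparr>pc = 18, idx = f(5 := f 5 + k + 1, 6 := f 5 + k), cell = g\<rparr>"
  using assms
proof (induction k arbitrary: f)
  case 0
  have "reaches jer_program (Suc (Suc (Suc 0))) N \<lparr>pc = 15, idx = f, cell = g\<rparr>
     \<lparr>pc = 18, idx = f(5 := f 5 + 1, 6 := f 5), cell = g\<rparr>"
    by (rule reaches_step, (use 0 in \<open>simp add: step_simps\<close>; fail)+)+
       (use 0 in \<open>simp add: reaches_refl\<close>)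
  then show ?case by (simp add: numeral_3_eq_3 fun_upd_def)
next
  case (Suc k)
  let ?f = "f(5 := f 5 + 1, 6 := f 5 + 2 * k + 2)"
  have step: "reaches jer_program (Suc (Suc (Suc 0))) N \<lparr>pc = 15, idx = f, cell = g\<rparr>
     \<lparr>pc = 15, idx = ?f, cell = g\<rparr>"
    by (rule reaches_step, (use Suc.prems in \<open>simp add: step_simps\<close>; fail)+)+
       (use Suc.prems in \<open>simp add: reaches_refl\<close>)
  have rest: "reaches jer_program (3 * Suc k) N \<lparr>pc = 15, idx = ?f, cell = g\<rparr>
     \<lparr>pc = 18, idx = ?f(5 := ?f 5 + k + 1, 6 := ?f 5 + k), cell = g\<rparr>"
    by (rule Suc.IH) simp
  have f: "?f(5 := ?f 5 + k + 1, 6 := ?f 5 + k) = f(5 := f 5 + Suc k + 1, 6 := f 5 + Suc k)"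
    by (simp add: fun_eq_iff)
  show ?case
    using reaches_trans[OF step rest[unfolded f]] by (rule reaches_mono) simp_all
qed

section \<open>Correctness and total cost\<close>

lemma jer_program_reaches:
  assumes "odd n"
  shows "\<exists>c. reaches jer_program (7 * n ^ 2 + 10 * n + 10) {0..2 * n + 1} (init n \<epsilon>) c \<and>
     halted jer_program c \<and> cell c 0 = JER n \<epsilon>"
proof -
  obtain k where n: "n = 2 * k + 1" using assms by (auto elim: oddE)
  let ?N = "{0..2 * n + 1}"
  let ?f = "(\<lambda>_. 0)(0 := n, 5 := n + 1, 6 := n + 1)"
  let ?g = "(\<lambda>a. if a \<in> {1..n} then \<epsilon> a else 0)(n + 1 := 1)"
  have start: "reaches jer_program (Suc (Suc (Suc (Suc 0)))) ?N (init n \<epsilon>)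
      \<lparr>pc = 4, idx = ?f, cell = ?g\<rparr>"
    unfolding init_def
    by (rule reaches_step, (simp add: step_simps; fail)+)+
       (simp add: eval_nat_numeral reaches_refl)
  \<comment> \<open>With no juror added, the table is 1 at \<open>k = 0\<close> and 0 elsewhere, as
    left by initialization.\<close>
  have "\<forall>k. ?g (n + 1 + k) = tail_prob {n<..n} \<epsilon> k"
    by (auto simp: tail_prob_0 tail_prob_eq_0)
  then obtain f g where loop: "reaches jer_program (n * (7 * n + 4)) ?N
       \<lparr>pc = 4, idx = ?f, cell = ?g\<rparr> \<lparr>pc = 15, idx = f, cell = g\<rparr>"
    and f: "f 4 = 0" "f 5 = n + 1" "f 6 = 2 * n + 1"
    and g: "\<forall>k. g (n + 1 + k) = tail_prob {0<..n} \<epsilon> k"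
    using outer_loop[of ?f "2 * k" n ?g \<epsilon>] by (auto simp: n)
  let ?f' = "f(5 := n + 1 + k + 1, 6 := n + 1 + k)"
  let ?c = "\<lparr>pc = 19, idx = ?f', cell = g(0 := g (n + 1 + (k + 1)))\<rparr>"
  \<comment> \<open>The gap is \<open>n = 2 * k + 1\<close>, so register 5 stops at table entry
    \<open>k + 1 = (n + 1) div 2\<close>.\<close>
  have middle: "reaches jer_program (3 * Suc k) ?N
       \<lparr>pc = 15, idx = f, cell = g\<rparr> \<lparr>pc = 18, idx = ?f', cell = g\<rparr>"
    using final_loop[of f k] f by (simp add: n)
  have copy: "reaches jer_program (Suc 0) ?N \<lparr>pc = 18, idx = ?f', cell = g\<rparr> ?c"
    by (rule reaches_step, (use f n in \<open>simp add: step_simps\<close>; fail)+)+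
       (simp add: n reaches_refl)
  \<comment> \<open>The phases add up to \<open>n * (7 * n + 4) + 3 * Suc k + 5\<close>, which is
    rounded up to avoid \<open>k\<close>.\<close>
  have "reaches jer_program (7 * n ^ 2 + 10 * n + 10) ?N (init n \<epsilon>) ?c"
    using reaches_trans[OF start reaches_trans[OF loop reaches_trans[OF middle copy]]]
    by (rule reaches_mono) (auto simp: n power2_eq_square algebra_simps)
  moreover have "halted jer_program ?c"
    by (simp add: halted_def jer_program_def)
  moreover have "cell ?c 0 = JER n \<epsilon>"
  proof -
    have "{0<..n} = {1..n}" "(n + 1) div 2 = k + 1" by (auto simp: n)
    then show ?thesis using g[rule_format, of "k + 1"] JER_eq_tail_prob[of n \<epsilon>] by simp
  qed
  ultimately show ?thesis by blast
qed

lemma jer_program_computes: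
  assumes "odd n"
  shows "computes_within jer_program n \<epsilon> (JER n \<epsilon>) (7 * n ^ 2 + 10 * n + 10)
     (2 * n + 2 + card (index_registers jer_program))"
proof -
  obtain c s M where c: "s \<le> 7 * n ^ 2 + 10 * n + 10" "M \<subseteq> {0..2 * n + 1}"
    "run jer_program (init n \<epsilon>) s M c" "halted jer_program c" "cell c 0 = JER n \<epsilon>"
    using jer_program_reaches[OF assms] unfolding reaches_def by blast
  \<comment> \<open>Input, output, scratch and table cells all lie in one interval of
    \<open>2 * n + 2\<close> addresses.\<close>
  have "card (M \<union> {0..n}) \<le> card {0..2 * n + 1}"
    using c(2) by (intro card_mono) auto
  then show ?thesis
    unfolding computes_within_def using c by (intro exI[of _ s] exI[of _ M] exI[of _ c]) simp
qed

theorem corollary1: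
  "\<exists>(P :: program) (T :: nat \<Rightarrow> nat) (S :: nat \<Rightarrow> nat).
     (\<lambda>n. real (T n)) \<in> O(\<lambda>n. real n ^ 2) \<and>
     (\<lambda>n. real (S n)) \<in> O(\<lambda>n. real n) \<and>
     (\<forall>(n :: nat) (\<epsilon> :: nat \<Rightarrow> real).
        odd n \<longrightarrow> (\<forall>i\<in>{1..n}. 0 < \<epsilon> i \<and> \<epsilon> i < 1) \<longrightarrow>
        computes_within P n \<epsilon> (JER n \<epsilon>) (T n) (S n))"
proof (intro exI conjI allI impI)
  show "(\<lambda>n. real (7 * n ^ 2 + 10 * n + 10)) \<in> O(\<lambda>n. real n ^ 2)"
  \<comment> \<open>\<open>27 = 7 + 10 + 10\<close>, as \<open>n\<close> and 1 are at most
    \<open>n ^ 2\<close> for \<open>n \<ge> 1\<close>.\<close>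
  proof (rule bigoI[where c = 27], rule eventually_mono[OF eventually_ge_at_top[of 1]])
    fix n :: nat
    assume "1 \<le> n"
    then have "n \<le> n ^ 2" "1 \<le> n ^ 2" by (simp_all add: power2_eq_square)
    then have "7 * n ^ 2 + 10 * n + 10 \<le> 27 * n ^ 2" by linarith
    then have "real (7 * n ^ 2 + 10 * n + 10) \<le> real (27 * n ^ 2)" by (rule of_nat_mono)
    then show "norm (real (7 * n ^ 2 + 10 * n + 10)) \<le> 27 * norm (real n ^ 2)" by simp
  qed
  show "(\<lambda>n. real (2 * n + 2 + card (index_registers jer_program))) \<in> O(\<lambda>n. real n)"
  proof (rule bigoI[where c = "real (4 + card (index_registers jer_program))"],
      rule eventually_mono[OF eventually_ge_at_top[of 1]])
    let ?r = "card (index_registers jer_program)"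
    fix n :: nat
    assume "1 \<le> n"
    then have "2 * n + 2 + ?r \<le> 4 * n + ?r * n" by (intro add_mono) simp_all
    then have "real (2 * n + 2 + ?r) \<le> real ((4 + ?r) * n)"
      by (intro of_nat_mono) (simp add: algebra_simps)
    then show "norm (real (2 * n + 2 + ?r)) \<le> real (4 + ?r) * norm (real n)" by simp
  qed
qed (rule jer_program_computes)

end
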